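(* Let $P$ be an ergodic Markov kernel on a finite set $\mathcal X$ with $n=|\mathcal X|\ge3$, reversible with respect to the strictly positive probability distribution $\pi$. Let $\eta_1\le\eta_2\le\cdots\le\eta_{n-1}$ be the eigenvalues of $P^2$ on $\ell^2_0(\pi)$, counted with multiplicity, and let $\phi\in\ell^2_0(\pi)$ satisfy $P^2\phi=\eta_1\phi$, $\|\phi\|_\pi=1$. For $\varnothing\ne S\subsetneq\mathcal X$ let $F(S)=\|G_SP-\Pi\|_{F,\pi}^2$, and let $$F_2^*=\min_{\varnothing\ne S\subsetneq\mathcal X}F(S),\qquad \delta_2(\phi)=\min_{\varnothing\ne S\subsetneq\mathcal X}\|(I-G_S)\phi\|_\pi^2 .$$ Order the states so that $\phi(x_{(1)})\le\cdots\le\phi(x_{(n)})$, put $S_j=\{x_{(1)},\ldots,x_{(j)}\}$ for $1\le j\le n-1$, and let $\widehat S\in\operatorname{argmin}_{1\le j\le n-1}F(S_j)$ be the output of the two-block spectral sweep, i.e. $\widehat S$ is one of the sets $S_1,\dots,S_{n-1}$ with smallest value of $F$. Then $$\eta_1+(\eta_2-\eta_1)\delta_2(\phi)\le F_2^*\le F(\widehat S)\le\eta_1+(\eta_{n-1}-\eta_1)\delta_2(\phi).$$ Consequently, $$0\le F(\widehat S)-F_2^*\le(\eta_{n-1}-\eta_2)\delta_2(\phi).$$ If $\eta_2>\eta_1$, then also $$F(\widehat S)-\eta_1\le\frac{\eta_{n-1}-\eta_1}{\eta_2-\eta_1}\,(F_2^*-\eta_1).$$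
   Context: $\pi(x)>0$ for all $x\in\mathcal X$. $\ell^2(\pi)$ is the space of real functions on $\mathcal X$ with $\langle f,g\rangle_\pi=\sum_x\pi(x)f(x)g(x)$ and norm $\|\cdot\|_\pi$; $\ell^2_0(\pi)=\{f:\sum_x\pi(x)f(x)=0\}$. Kernels act by $(Pf)(x)=\sum_yP(x,y)f(y)$. Ergodic means irreducible and aperiodic; reversible means $\pi(x)P(x,y)=\pi(y)P(y,x)$ for all $x,y$. $\Pi(x,y)=\pi(y)$. For $\varnothing\ne S\subsetneq\mathcal X$, $G_S$ is the two-block Gibbs kernel, replacing a function by its $\pi$-weighted mean on each of $S$ and $S^c$: $(G_Sf)(x)=\frac1{\pi(S)}\sum_{y\in S}\pi(y)f(y)$ for $x\in S$ and $(G_Sf)(x)=\frac1{\pi(S^c)}\sum_{y\in S^c}\pi(y)f(y)$ for $x\in S^c$. For an operator $A$ on $\ell^2(\pi)$, $\|A\|_{F,\pi}^2=\operatorname{Tr}(A^*A)=\sum_{x,y}\frac{\pi(x)}{\pi(y)}A(x,y)^2$. *)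

theory Defs
  imports "HOL-Analysis.Analysis"
begin

text \<open>The state space is a finite type \<open>'a\<close>. Functions on it are vectors \<open>real ^ 'a\<close>, and kernels and
  operators are matrices \<open>real ^ 'a ^ 'a\<close> with \<open>A(x,y) = A $ x $ y\<close>, so that the action on
  functions is \<open>A *v f\<close> and composition is \<open>A ** B\<close>.\<close>

definition prob_distr :: "('a::finite \<Rightarrow> real) \<Rightarrow> bool" where
  "prob_distr \<pi> \<longleftrightarrow> (\<forall>x. 0 \<le> \<pi> x) \<and> (\<Sum>x\<in>UNIV. \<pi> x) = 1"

definition markov_kernel :: "real ^ 'a ^ 'a::finite \<Rightarrow> bool" where
  "markov_kernel P \<longleftrightarrow> (\<forall>x y. 0 \<le> P $ x $ y) \<and> (\<forall>x. (\<Sum>y\<in>UNIV. P $ x $ y) = 1)"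

text \<open>The overloaded \<open>*\<close> and \<open>^\<close> on \<open>real ^ 'a ^ 'a\<close> are componentwise, so iterates need their own definition.\<close>

primrec kernel_pow :: "real ^ 'a ^ 'a::finite \<Rightarrow> nat \<Rightarrow> real ^ 'a ^ 'a" where
  "kernel_pow P 0 = mat 1"
| "kernel_pow P (Suc k) = P ** kernel_pow P k"

definition irreducible_kernel :: "real ^ 'a ^ 'a::finite \<Rightarrow> bool" where
  "irreducible_kernel P \<longleftrightarrow> (\<forall>x y. \<exists>k. kernel_pow P k $ x $ y > 0)"

definition aperiodic_kernel :: "real ^ 'a ^ 'a::finite \<Rightarrow> bool" where
  "aperiodic_kernel P \<longleftrightarrow> (\<forall>x. Gcd {k::nat. k \<ge> 1 \<and> kernel_pow P k $ x $ x > 0} = 1)"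

definition ergodic_kernel :: "real ^ 'a ^ 'a::finite \<Rightarrow> bool" where
  "ergodic_kernel P \<longleftrightarrow> irreducible_kernel P \<and> aperiodic_kernel P"

definition reversible_kernel :: "('a::finite \<Rightarrow> real) \<Rightarrow> real ^ 'a ^ 'a \<Rightarrow> bool" where
  "reversible_kernel \<pi> P \<longleftrightarrow> (\<forall>x y. \<pi> x * P $ x $ y = \<pi> y * P $ y $ x)"

definition pi_inner :: "('a::finite \<Rightarrow> real) \<Rightarrow> real ^ 'a \<Rightarrow> real ^ 'a \<Rightarrow> real" where
  "pi_inner \<pi> f g = (\<Sum>x\<in>UNIV. \<pi> x * f $ x * g $ x)"

definition pi_norm :: "('a::finite \<Rightarrow> real) \<Rightarrow> real ^ 'a \<Rightarrow> real" where
  "pi_norm \<pi> f = sqrt (pi_inner \<pi> f f)"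

definition l2_0 :: "('a::finite \<Rightarrow> real) \<Rightarrow> (real ^ 'a) set" where
  "l2_0 \<pi> = {f. (\<Sum>x\<in>UNIV. \<pi> x * f $ x) = 0}"

definition stationary_kernel :: "('a::finite \<Rightarrow> real) \<Rightarrow> real ^ 'a ^ 'a" where
  "stationary_kernel \<pi> = (\<chi> x y. \<pi> y)"

definition pi_mean :: "('a::finite \<Rightarrow> real) \<Rightarrow> 'a set \<Rightarrow> real ^ 'a \<Rightarrow> real" where
  "pi_mean \<pi> S f = 1 / (\<Sum>y\<in>S. \<pi> y) * (\<Sum>y\<in>S. \<pi> y * f $ y)"

definition gibbs_op :: "('a::finite \<Rightarrow> real) \<Rightarrow> 'a set \<Rightarrow> real ^ 'a \<Rightarrow> real ^ 'a" where
  "gibbs_op \<pi> S f = (\<chi> x. if x \<in> S then pi_mean \<pi> S f else pi_mean \<pi> (- S) f)"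

definition gibbs :: "('a::finite \<Rightarrow> real) \<Rightarrow> 'a set \<Rightarrow> real ^ 'a ^ 'a" where
  "gibbs \<pi> S = matrix (gibbs_op \<pi> S)"

lemma gibbs_apply: "gibbs \<pi> S *v f = gibbs_op \<pi> S f"
proof -
  have "Vector_Spaces.linear (*s) (*s) (gibbs_op \<pi> S)"
    by unfold_locales
      (auto simp: vec_eq_iff gibbs_op_def pi_mean_def sum.distrib sum_distrib_left algebra_simps)
  then show ?thesis unfolding gibbs_def by (rule matrix_works)
qed

definition pi_frob_norm :: "('a::finite \<Rightarrow> real) \<Rightarrow> real ^ 'a ^ 'a \<Rightarrow> real" where
  "pi_frob_norm \<pi> A = sqrt (\<Sum>x\<in>UNIV. \<Sum>y\<in>UNIV. \<pi> x / \<pi> y * (A $ x $ y)\<^sup>2)"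

definition l2_0_eigenspace :: "('a::finite \<Rightarrow> real) \<Rightarrow> real ^ 'a ^ 'a \<Rightarrow> real \<Rightarrow> (real ^ 'a) set" where
  "l2_0_eigenspace \<pi> A c = {f \<in> l2_0 \<pi>. A *v f = c *\<^sub>R f}"

definition l2_0_eigenvalues :: "('a::finite \<Rightarrow> real) \<Rightarrow> real ^ 'a ^ 'a \<Rightarrow> real set" where
  "l2_0_eigenvalues \<pi> A = {c. \<exists>f \<in> l2_0_eigenspace \<pi> A c. f \<noteq> 0}"

text \<open>The eigenvalues on \<open>l2_0 \<pi>\<close> in increasing order, each repeated as often as the dimension of its
  eigenspace. For operators that are self-adjoint with respect to \<open>\<pi>\<close> geometric and algebraic
  multiplicities coincide, and the list has length \<open>CARD('a) - 1\<close>.\<close>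

definition l2_0_spectrum :: "('a::finite \<Rightarrow> real) \<Rightarrow> real ^ 'a ^ 'a \<Rightarrow> real list" where
  "l2_0_spectrum \<pi> A =
     concat (map (\<lambda>c. replicate (dim (l2_0_eigenspace \<pi> A c)) c)
       (sorted_list_of_set (l2_0_eigenvalues \<pi> A)))"

text \<open>The \<open>k\<close>-th smallest eigenvalue of \<open>P\<^sup>2\<close> on \<open>l2_0 \<pi>\<close>, counted from \<open>k = 1\<close>.\<close>

definition sq_eigenvalue :: "('a::finite \<Rightarrow> real) \<Rightarrow> real ^ 'a ^ 'a \<Rightarrow> nat \<Rightarrow> real" where
  "sq_eigenvalue \<pi> P k = l2_0_spectrum \<pi> (P ** P) ! (k - 1)"

definition gibbs_cost :: "('a::finite \<Rightarrow> real) \<Rightarrow> real ^ 'a ^ 'a \<Rightarrow> 'a set \<Rightarrow> real" where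
  "gibbs_cost \<pi> P S = (pi_frob_norm \<pi> (gibbs \<pi> S ** P - stationary_kernel \<pi>))\<^sup>2"

definition two_block_opt :: "('a::finite \<Rightarrow> real) \<Rightarrow> real ^ 'a ^ 'a \<Rightarrow> real" where
  "two_block_opt \<pi> P = (MIN S\<in>{S. S \<noteq> {} \<and> S \<noteq> UNIV}. gibbs_cost \<pi> P S)"

definition two_block_defect :: "('a::finite \<Rightarrow> real) \<Rightarrow> real ^ 'a \<Rightarrow> real" where
  "two_block_defect \<pi> \<phi> =
     (MIN S\<in>{S. S \<noteq> {} \<and> S \<noteq> UNIV}. (pi_norm \<pi> ((mat 1 - gibbs \<pi> S) *v \<phi>))\<^sup>2)"

text \<open>\<open>x 1, \<dots>, x n\<close> enumerates the states with \<open>\<phi>\<close> nondecreasing; ties may be broken arbitrarily.\<close>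

definition sweep_order :: "real ^ 'a::finite \<Rightarrow> (nat \<Rightarrow> 'a) \<Rightarrow> bool" where
  "sweep_order \<phi> x \<longleftrightarrow> bij_betw x {1..CARD('a)} UNIV \<and>
     (\<forall>i j. 1 \<le> i \<and> i \<le> j \<and> j \<le> CARD('a) \<longrightarrow> \<phi> $ x i \<le> \<phi> $ x j)"

definition sweep_sets :: "(nat \<Rightarrow> 'a::finite) \<Rightarrow> 'a set set" where
  "sweep_sets x = {x ` {1..j} | j. 1 \<le> j \<and> j \<le> CARD('a) - 1}"

definition sweep_output :: "('a::finite \<Rightarrow> real) \<Rightarrow> real ^ 'a ^ 'a \<Rightarrow> (nat \<Rightarrow> 'a) \<Rightarrow> 'a set \<Rightarrow> bool" where
  "sweep_output \<pi> P x S \<longleftrightarrow> is_arg_min (gibbs_cost \<pi> P) (\<lambda>T. T \<in> sweep_sets x) S"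

end

theory Submission imports Defs begin

text \<open>On \<open>l2_0 \<pi>\<close> the operator \<open>G\<^sub>S\<close> is the rank-one projection onto \<open>v = 1\<^sub>S - \<pi>(S)\<close>, which has
  squared norm \<open>\<pi>(S) \<pi>(S\<^sup>c)\<close>. Hence \<open>F(S) = \<langle>v, P\<^sup>2v\<rangle> / (\<pi>(S) \<pi>(S\<^sup>c))\<close> is a Rayleigh quotient. Splitting \<open>v\<close>
  into its component along \<open>\<phi>\<close> and a remainder orthogonal to \<open>\<phi>\<close>, on which \<open>P\<^sup>2\<close> lies between \<open>\<eta>\<^sub>2\<close> and
  \<open>\<eta>\<^bsub>n-1\<^esub>\<close>, gives for every \<open>S\<close>, with \<open>d(S) = \<parallel>(I - G\<^sub>S)\<phi>\<parallel>\<^sup>2\<close>,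
  \<open>\<eta>\<^sub>1 + (\<eta>\<^sub>2 - \<eta>\<^sub>1) d(S) \<le> F(S) \<le> \<eta>\<^sub>1 + (\<eta>\<^bsub>n-1\<^esub> - \<eta>\<^sub>1) d(S)\<close>.
  Minimizing \<open>d\<close> is a one-dimensional 2-means problem for the values of \<open>\<phi>\<close>, so its minimum is
  attained at one of the sweep sets.\<close>

subsection \<open>Self-adjoint operators on Euclidean spaces\<close>

text \<open>Near \<open>t = 0\<close> the linear term dominates, so a nonzero \<open>b\<close> would
  force a negative value. This serves as the first-order condition along lines through a
  minimizer.\<close>

lemma quadratic_nonneg_imp_linear_zero:
  fixes b q :: real
  assumes "\<And>t. 0 \<le> 2 * t * b + t\<^sup>2 * q"
  shows "b = 0"
proof (rule ccontr)
  assume b: "b \<noteq> 0"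
  \<comment> \<open>The sign is opposite to that of \<open>b\<close>, and the denominator is
    positive even for \<open>q = 0\<close>. It leaves the factor
    \<open>2 * \<bar>q\<bar> + 2 - q\<close>, which is positive whatever the sign of
    \<open>q\<close>.\<close>
  define s where "s = - b / (\<bar>q\<bar> + 1)"
  have s: "s * (\<bar>q\<bar> + 1) = - b"
    by (simp add: s_def)
  have "s \<noteq> 0" using b by (auto simp: s_def add_nonneg_eq_0_iff)
  then have s2: "s\<^sup>2 > 0" by simp
  have "2 * s * b + s\<^sup>2 * q = - s\<^sup>2 * (2 * \<bar>q\<bar> + 2 - q)"
    using arg_cong[OF s, of "\<lambda>u. 2 * s * u"] by (simp add: algebra_simps power2_eq_square)
  also have "\<dots> < 0"
    using s2 by (simp add: mult_pos_pos)
  finally show False using assms[of s] by simp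
qed

text \<open>Compactness gives a minimizer \<open>u\<close> of \<open>x \<bullet> T x\<close> on the
  unit sphere of \<open>V\<close>. The first-order condition makes
  \<open>T u - m *\<^sub>R u\<close> orthogonal to \<open>V\<close>, and invariance puts it into
  \<open>V\<close>, so it vanishes.\<close>

lemma rayleigh_min_eigenvector:
  fixes T :: "'b::euclidean_space \<Rightarrow> 'b"
  assumes T: "linear T" and sa: "\<And>x y. x \<in> V \<Longrightarrow> y \<in> V \<Longrightarrow> T x \<bullet> y = x \<bullet> T y"
    and V: "subspace V" and TV: "\<And>x. x \<in> V \<Longrightarrow> T x \<in> V" and ne: "V \<noteq> {0}"
  shows "\<exists>u\<in>V. \<exists>m. norm u = 1 \<and> T u = m *\<^sub>R u \<and> (\<forall>x\<in>V. m * (x \<bullet> x) \<le> x \<bullet> T x)"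
proof -
  let ?K = "V \<inter> sphere 0 1"
  have "compact ?K"
    by (metis V closed_subspace compact_Int_closed compact_sphere inf_commute)
  moreover obtain z where z: "z \<in> V" "z \<noteq> 0"
    using ne subspace_0[OF V] by blast
  then have "z /\<^sub>R norm z \<in> ?K"
    using subspace_scale[OF V] by auto
  then have "?K \<noteq> {}" by blast
  moreover have "continuous_on ?K (\<lambda>x. x \<bullet> T x)"
    using linear_continuous_on[OF linear_conv_bounded_linear[THEN iffD1, OF T]]
    by (intro continuous_on_inner continuous_on_id)
  ultimately obtain u where u: "u \<in> ?K" and min: "\<And>x. x \<in> ?K \<Longrightarrow> u \<bullet> T u \<le> x \<bullet> T x"
    by (meson continuous_attains_inf)
  define m where "m = u \<bullet> T u"
  have uV: "u \<in> V" and nu: "norm u = 1" and uu: "u \<bullet> u = 1"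
    using u by (auto simp: dot_square_norm)
  have bound: "m * (x \<bullet> x) \<le> x \<bullet> T x" if x: "x \<in> V" for x
  proof (cases "x = 0")
    case False
    have "x /\<^sub>R norm x \<in> ?K"
      using x False subspace_scale[OF V] by auto
    from min[OF this] have "m \<le> (x \<bullet> T x) / (x \<bullet> x)"
      by (simp add: m_def linear_scale[OF T] dot_square_norm power2_eq_square divide_simps)
    then show ?thesis using False by (simp add: pos_le_divide_eq)
  qed simp
  \<comment> \<open>Along \<open>u + t *\<^sub>R y\<close> the terms constant in \<open>t\<close>
    cancel because \<open>m = u \<bullet> T u\<close> and \<open>u\<close> is a unit vector; the
    linear coefficient that remains is the inner product in question.\<close>
  have ortho: "y \<bullet> (T u - m *\<^sub>R u) = 0" if y: "y \<in> V" for y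
  proof (rule quadratic_nonneg_imp_linear_zero)
    fix t :: real
    have sym: "u \<bullet> T y = y \<bullet> T u"
      using sa[OF uV y] by (simp add: inner_commute)
    have "u + t *\<^sub>R y \<in> V"
      using V uV y by (simp add: subspace_add subspace_scale)
    from bound[OF this] have "m * ((u + t *\<^sub>R y) \<bullet> (u + t *\<^sub>R y)) \<le> (u + t *\<^sub>R y) \<bullet> T (u + t *\<^sub>R y)" .
    then show "0 \<le> 2 * t * (y \<bullet> (T u - m *\<^sub>R u)) + t\<^sup>2 * (y \<bullet> T y - m * (y \<bullet> y))"
      using sym uu by (simp add: linear_add[OF T] linear_scale[OF T] inner_add_left inner_add_right
          inner_diff_right inner_commute[of u y] m_def algebra_simps power2_eq_square)
  qed
  have "T u - m *\<^sub>R u \<in> V"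
    using V uV TV by (simp add: subspace_diff subspace_scale)
  with ortho have "T u = m *\<^sub>R u"
    by (metis inner_eq_zero_iff right_minus_eq)
  with uV nu bound show ?thesis by blast
qed

text \<open>Induction on \<open>dim V\<close>: a unit eigenvector \<open>u\<close> is split off.
  Self-adjointness keeps its orthogonal complement in \<open>V\<close> invariant under
  \<open>T\<close>, and this complement has smaller dimension.\<close>

lemma orthonormal_eigenbasis:
  fixes T :: "'b::euclidean_space \<Rightarrow> 'b"
  assumes T: "linear T" and sa: "\<And>x y. x \<in> V \<Longrightarrow> y \<in> V \<Longrightarrow> T x \<bullet> y = x \<bullet> T y"
    and V: "subspace V" and TV: "\<And>x. x \<in> V \<Longrightarrow> T x \<in> V"
  obtains B ev where "B \<subseteq> V" "finite B" "pairwise orthogonal B" "\<And>b. b \<in> B \<Longrightarrow> norm b = 1"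
    "span B = V" "\<And>b. b \<in> B \<Longrightarrow> T b = ev b *\<^sub>R b"
proof -
  have "\<exists>B ev. B \<subseteq> V \<and> finite B \<and> pairwise orthogonal B \<and> (\<forall>b\<in>B. norm b = 1)
      \<and> V \<subseteq> span B \<and> (\<forall>b\<in>B. T b = ev b *\<^sub>R b)"
    using sa V TV
  proof (induction "dim V" arbitrary: V rule: less_induct)
    case less
    show ?case
    proof (cases "V = {0}")
      case True
      then show ?thesis by (intro exI[of _ "{}"]) auto
    next
      case False
      obtain u m where u: "u \<in> V" "norm u = 1" "T u = m *\<^sub>R u"
        using rayleigh_min_eigenvector[OF T less.prems(1,2) less.prems(3) False] by blast
      define W where "W = {x \<in> V. u \<bullet> x = 0}"
      have W: "subspace W"
        using less.prems(2) by (auto simp: W_def subspace_def inner_add_right)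
      have "u \<notin> W" using u by (auto simp: W_def)
      then have "dim W < dim V"
        using u W less.prems(2) by (metis (no_types, lifting) W_def dim_psubset mem_Collect_eq
            psubsetI span_eq_iff subsetI)
      moreover have "T x \<in> W" if "x \<in> W" for x
        using that u less.prems(1)[of u x] less.prems(3)[of x] by (auto simp: W_def)
      moreover have "T x \<bullet> y = x \<bullet> T y" if "x \<in> W" "y \<in> W" for x y
        using that less.prems(1) by (auto simp: W_def)
      ultimately obtain B ev where B: "B \<subseteq> W" "finite B" "pairwise orthogonal B"
          "\<forall>b\<in>B. norm b = 1" "W \<subseteq> span B" "\<forall>b\<in>B. T b = ev b *\<^sub>R b"
        using less.hyps[OF _ _ W] by metis
      have "u \<notin> B" using B(1) \<open>u \<notin> W\<close> by blast
      have "x \<in> span (insert u B)" if "x \<in> V" for x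
      proof -
        have "x - (u \<bullet> x) *\<^sub>R u \<in> W"
          using that u less.prems(2) by (simp add: W_def subspace_diff subspace_scale
              inner_diff_right dot_square_norm)
        then show ?thesis
          using B(5) by (auto simp: span_breakdown_eq)
      qed
      moreover have "pairwise orthogonal (insert u B)"
        using B(1,3) by (auto simp: pairwise_insert orthogonal_def W_def inner_commute)
      moreover have "\<forall>b\<in>insert u B. T b = (ev(u := m)) b *\<^sub>R b"
        using B(6) u \<open>u \<notin> B\<close> by auto
      ultimately show ?thesis
        using B u by (intro exI[of _ "insert u B"] exI[of _ "ev(u := m)"]) (auto simp: W_def)
    qed
  qed
  then obtain B ev where B: "B \<subseteq> V" "finite B" "pairwise orthogonal B" "\<forall>b\<in>B. norm b = 1"
      "V \<subseteq> span B" "\<forall>b\<in>B. T b = ev b *\<^sub>R b" by blast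
  moreover have "span B = V"
    using B(1,5) V by (metis span_minimal subset_antisym)
  ultimately show thesis using that by blast
qed

text \<open>In an orthonormal eigenbasis \<open>B\<close>, the vectors with eigenvalue
  \<open>c\<close> span the eigenspace of \<open>c\<close>, so its dimension counts them; grouping
  \<open>B\<close> by eigenvalue then counts all of \<open>B\<close>.\<close>

lemma sum_dim_eigenspaces:
  fixes T :: "'b::euclidean_space \<Rightarrow> 'b"
  assumes T: "linear T" and sa: "\<And>x y. x \<in> V \<Longrightarrow> y \<in> V \<Longrightarrow> T x \<bullet> y = x \<bullet> T y"
    and V: "subspace V" and TV: "\<And>x. x \<in> V \<Longrightarrow> T x \<in> V"
  defines "E \<equiv> \<lambda>c. {f \<in> V. T f = c *\<^sub>R f}"
  shows "finite {c. \<exists>f \<in> E c. f \<noteq> 0}" and "(\<Sum>c | \<exists>f \<in> E c. f \<noteq> 0. dim (E c)) = dim V"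
proof -
  obtain B ev where B: "B \<subseteq> V" "finite B" "pairwise orthogonal B" "\<And>b. b \<in> B \<Longrightarrow> norm b = 1"
      "span B = V" "\<And>b. b \<in> B \<Longrightarrow> T b = ev b *\<^sub>R b"
    using orthonormal_eigenbasis[OF T sa V TV] by metis
  have indep: "independent B"
    using B(3,4) by (intro pairwise_orthogonal_independent) force+
  have E: "E c = span {b \<in> B. ev b = c}" for c
  proof
    show "E c \<subseteq> span {b \<in> B. ev b = c}"
    proof
      fix f assume f: "f \<in> E c"
      \<comment> \<open>Both \<open>c * (f \<bullet> b)\<close> and
        \<open>ev b * (f \<bullet> b)\<close> equal \<open>T f \<bullet> b\<close>.\<close>
      have z: "f \<bullet> b = 0" if b: "b \<in> B" "ev b \<noteq> c" for b
      proof -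
        have "c * (f \<bullet> b) = ev b * (f \<bullet> b)"
          using f sa[of f b] B(1) B(6)[OF b(1)] b by (auto simp: E_def)
        then show ?thesis using b by auto
      qed
      have "f = (\<Sum>b\<in>B. (f \<bullet> b) *\<^sub>R b)"
        using f B by (intro orthonormal_basis_expand[symmetric]) (auto simp: E_def)
      also have "\<dots> = (\<Sum>b | b \<in> B \<and> ev b = c. (f \<bullet> b) *\<^sub>R b)"
        using B(2) z by (intro sum.mono_neutral_right) auto
      also have "\<dots> \<in> span {b \<in> B. ev b = c}"
        by (intro span_sum span_scale span_base) auto
      finally show "f \<in> span {b \<in> B. ev b = c}" .
    qed
    have "subspace (E c)"
      using V by (auto simp: E_def subspace_def linear_0[OF T] linear_add[OF T] linear_scale[OF T]
          scaleR_add_right)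
    moreover have "{b \<in> B. ev b = c} \<subseteq> E c"
      using B(1,6) by (auto simp: E_def)
    ultimately show "span {b \<in> B. ev b = c} \<subseteq> E c"
      by (rule span_minimal[rotated])
  qed
  have dimE: "dim (E c) = card {b \<in> B. ev b = c}" for c
    unfolding E by (rule dim_span_eq_card_independent) (rule independent_mono[OF indep], auto)
  have img: "{c. \<exists>f \<in> E c. f \<noteq> 0} = ev ` B"
  proof (intro equalityI subsetI)
    fix c assume "c \<in> {c. \<exists>f \<in> E c. f \<noteq> 0}"
    then have "dim (E c) \<noteq> 0" by auto
    then have "{b \<in> B. ev b = c} \<noteq> {}" unfolding dimE by (metis card.empty)
    then show "c \<in> ev ` B" by auto
  next
    fix c assume "c \<in> ev ` B"
    then obtain b where "b \<in> B" "ev b = c" by blast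
    then have "b \<in> E c" "b \<noteq> 0"
      using B(1,6) B(4)[of b] by (auto simp: E_def)
    then show "c \<in> {c. \<exists>f \<in> E c. f \<noteq> 0}" by blast
  qed
  show "finite {c. \<exists>f \<in> E c. f \<noteq> 0}"
    unfolding img using B(2) by simp
  have "dim V = card B"
    using indep B(5) by (metis dim_span_eq_card_independent)
  also have "\<dots> = (\<Sum>c\<in>ev ` B. card {b \<in> B. ev b = c})"
    using sum.image_gen[OF B(2), of "\<lambda>_. 1::nat" ev] by simp
  finally show "(\<Sum>c | \<exists>f \<in> E c. f \<noteq> 0. dim (E c)) = dim V"
    unfolding img dimE by simp
qed

section \<open>Sorted lists with prescribed multiplicities\<close>

lemma sorted_concat_replicate:
  "sorted cs \<Longrightarrow> sorted (concat (map (\<lambda>c. replicate (d c) c) cs))"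
  by (induction cs) (auto simp: sorted_append)

lemma length_concat_replicate:
  "distinct cs \<Longrightarrow> length (concat (map (\<lambda>c. replicate (d c) c) cs)) = (\<Sum>c\<in>set cs. d c)"
  by (induction cs) auto

lemma count_list_replicate: "count_list (replicate n a) b = (if a = b then n else 0)"
  by (induction n) auto

lemma count_list_concat_replicate:
  "distinct cs \<Longrightarrow> count_list (concat (map (\<lambda>c. replicate (d c) c) cs)) c = (if c \<in> set cs then d c else 0)"
  by (induction cs) (auto simp: count_list_replicate)

text \<open>If \<open>c\<close> differs from the head, it lies in the tail; if it equals the head,
  its second copy lies there. The tail is sorted and starts with \<open>xs ! 1\<close>.\<close>

lemma nth_1_le_of_count_list:
  fixes xs :: "'b::linorder list"
  assumes "sorted xs" and "c \<in> set xs" and "c = xs ! 0 \<Longrightarrow> 2 \<le> count_list xs c"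
  shows "xs ! 1 \<le> c"
proof -
  obtain y ys where xs: "xs = y # ys" using assms(2) by (cases xs) auto
  have "c \<in> set ys"
    using assms(2,3) xs count_list_0_iff[of ys c] by (cases "c = y") auto
  then obtain z zs where "ys = z # zs" by (cases ys) auto
  then show ?thesis using assms(1) \<open>c \<in> set ys\<close> xs by auto
qed

subsection \<open>The spectrum of a \<open>\<pi>\<close>-self-adjoint operator on \<open>l2_0 \<pi>\<close>\<close>

text \<open>For positive \<open>\<pi>\<close> this is an isometry from the weighted space onto
  Euclidean space, which carries the Euclidean spectral results over. Its inverse is
  \<open>pi_scale\<close> with weights \<open>1 / \<pi> z\<close>.\<close>

definition pi_scale :: "('a::finite \<Rightarrow> real) \<Rightarrow> real ^ 'a \<Rightarrow> real ^ 'a" where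
  "pi_scale \<pi> f = (\<chi> x. sqrt (\<pi> x) * f $ x)"

lemma linear_pi_scale: "linear (pi_scale \<pi>)"
  by (auto intro!: linearI simp: pi_scale_def vec_eq_iff algebra_simps)

lemma pi_scale_inner:
  assumes "\<And>z. 0 < \<pi> z"
  shows "pi_scale \<pi> f \<bullet> pi_scale \<pi> g = pi_inner \<pi> f g"
proof -
  have "sqrt (\<pi> z) * f $ z * (sqrt (\<pi> z) * g $ z) = \<pi> z * f $ z * g $ z" for z
    using real_sqrt_mult_self[of "\<pi> z"] assms[of z] by (simp add: algebra_simps)
  then show ?thesis unfolding pi_scale_def inner_vec_def pi_inner_def by (simp only: vec_lambda_beta inner_real_def)
qed

lemma pi_scale_inverse:
  assumes "\<And>z. 0 < \<pi> z"
  shows "pi_scale (\<lambda>z. 1 / \<pi> z) (pi_scale \<pi> f) = f" "pi_scale \<pi> (pi_scale (\<lambda>z. 1 / \<pi> z) f) = f"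
  using assms by (auto simp: pi_scale_def vec_eq_iff real_sqrt_divide less_imp_neq[THEN not_sym])

lemma pi_inner_commute: "pi_inner \<pi> f g = pi_inner \<pi> g f"
  by (simp add: pi_inner_def mult.commute mult.left_commute)

lemma pi_inner_add_left: "pi_inner \<pi> (f + h) g = pi_inner \<pi> f g + pi_inner \<pi> h g"
  by (simp add: pi_inner_def algebra_simps sum.distrib)

lemma pi_inner_scaleR_left: "pi_inner \<pi> (c *\<^sub>R f) g = c * pi_inner \<pi> f g"
  by (simp add: pi_inner_def sum_distrib_left algebra_simps)

lemma pi_inner_add_right: "pi_inner \<pi> g (f + h) = pi_inner \<pi> g f + pi_inner \<pi> g h"
  by (metis pi_inner_commute pi_inner_add_left)

lemma pi_inner_scaleR_right: "pi_inner \<pi> g (c *\<^sub>R f) = c * pi_inner \<pi> g f"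
  by (metis pi_inner_commute pi_inner_scaleR_left)

lemma pi_inner_minus_right: "pi_inner \<pi> g (- f) = - pi_inner \<pi> g f"
  using pi_inner_scaleR_right[of \<pi> g "-1" f] by simp

lemma pi_inner_minus_left: "pi_inner \<pi> (- f) g = - pi_inner \<pi> f g"
  by (metis pi_inner_commute pi_inner_minus_right)

lemma pi_inner_self_nonneg:
  assumes "\<And>z. 0 < \<pi> z"
  shows "0 \<le> pi_inner \<pi> f f"
  by (metis assms inner_ge_zero pi_scale_inner)

lemma subspace_l2_0: "subspace (l2_0 \<pi>)"
  by (auto simp: subspace_def l2_0_def algebra_simps sum.distrib simp flip: sum_distrib_left)

text \<open>Kept abstract so that it applies to \<open>P ** P\<close> and also to the negative of an
  operator, which turns bounds by smallest eigenvalues into bounds by largest ones.\<close>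

locale pi_self_adjoint =
  fixes \<pi> :: "'a::finite \<Rightarrow> real" and A :: "real ^ 'a ^ 'a"
  assumes pos: "\<And>z. 0 < \<pi> z"
    and self_adjoint: "\<And>f g. pi_inner \<pi> (A *v f) g = pi_inner \<pi> f (A *v g)"
    and invariant: "\<And>f. f \<in> l2_0 \<pi> \<Longrightarrow> A *v f \<in> l2_0 \<pi>"
begin

text \<open>The similarity transform of \<open>A\<close> by the square root of \<open>\<pi>\<close>:
  self-adjoint for the Euclidean inner product, with the same eigenvalues as
  \<open>A\<close>.\<close>

definition conj_op :: "real ^ 'a \<Rightarrow> real ^ 'a" where
  "conj_op f = pi_scale \<pi> (A *v pi_scale (\<lambda>z. 1 / \<pi> z) f)"

lemma conj_op_pi_scale: "conj_op (pi_scale \<pi> f) = pi_scale \<pi> (A *v f)"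
  by (simp add: conj_op_def pi_scale_inverse pos)

lemma linear_conj_op: "linear conj_op"
  by (rule linearI)
    (simp_all add: conj_op_def linear_add[OF linear_pi_scale] linear_scale[OF linear_pi_scale]
      matrix_vector_right_distrib matrix_vector_mult_scaleR)

lemma conj_op_self_adjoint: "conj_op f \<bullet> g = f \<bullet> conj_op g"
  by (metis conj_op_pi_scale pi_scale_inner pi_scale_inverse(2) pos self_adjoint)

lemma inj_pi_scale: "inj (pi_scale \<pi>)"
  by (metis injI pi_scale_inverse(1) pos)

lemma pi_scale_eq_0: "pi_scale \<pi> f = 0 \<longleftrightarrow> f = 0"
  using inj_pi_scale linear_0[OF linear_pi_scale] by (metis injD)

lemma rayleigh_min_eigenvector_pi:
  assumes V: "subspace V" and AV: "\<And>f. f \<in> V \<Longrightarrow> A *v f \<in> V" and "V \<noteq> {0}"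
  shows "\<exists>u\<in>V. \<exists>m. u \<noteq> 0 \<and> A *v u = m *\<^sub>R u
    \<and> (\<forall>f\<in>V. m * pi_inner \<pi> f f \<le> pi_inner \<pi> f (A *v f))"
proof -
  let ?V = "pi_scale \<pi> ` V"
  have V': "subspace ?V"
    by (rule linear_subspace_image[OF linear_pi_scale V])
  have ne: "?V \<noteq> {0}"
    using \<open>V \<noteq> {0}\<close> subspace_0[OF V] pi_scale_eq_0 by (auto simp: set_eq_iff)
  have inv: "conj_op f \<in> ?V" if "f \<in> ?V" for f
    using that AV by (auto simp: conj_op_pi_scale)
  obtain u m where u: "u \<in> ?V" "norm u = 1" "conj_op u = m *\<^sub>R u"
      "\<forall>f\<in>?V. m * (f \<bullet> f) \<le> f \<bullet> conj_op f"
    using rayleigh_min_eigenvector[OF linear_conj_op _ V' inv ne] conj_op_self_adjoint by blast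
  obtain v where v: "v \<in> V" "u = pi_scale \<pi> v" using u(1) by blast
  have "pi_scale \<pi> (A *v v) = pi_scale \<pi> (m *\<^sub>R v)"
    using u(3) v by (simp add: conj_op_pi_scale linear_scale[OF linear_pi_scale])
  then have "A *v v = m *\<^sub>R v" using inj_pi_scale by (metis injD)
  moreover have "v \<noteq> 0" using u(2) v pi_scale_eq_0[of v] by auto
  moreover have "m * pi_inner \<pi> f f \<le> pi_inner \<pi> f (A *v f)" if "f \<in> V" for f
    using u(4)[rule_format, of "pi_scale \<pi> f"] that by (simp add: conj_op_pi_scale pi_scale_inner pos)
  ultimately show ?thesis using v(1) by blast
qed

lemma dim_pi_scale_image: "dim (pi_scale \<pi> ` V) = dim V"
  by (rule dim_image_eq[OF linear_pi_scale]) (simp add: inj_on_subset[OF inj_pi_scale])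

text \<open>The injective map \<open>pi_scale \<pi>\<close> sends \<open>l2_0 \<pi>\<close> onto the
  hyperplane orthogonal to the nonzero vector of square roots of \<open>\<pi>\<close>.\<close>

lemma dim_l2_0: "dim (l2_0 \<pi>) = CARD('a) - 1"
proof -
  let ?s = "(\<chi> x. sqrt (\<pi> x)) :: real ^ 'a"
  have "pi_scale \<pi> ` l2_0 \<pi> = {g. ?s \<bullet> g = 0}"
  proof (intro equalityI subsetI)
    fix g assume g: "g \<in> {g. ?s \<bullet> g = 0}"
    have "\<pi> z * (1 / sqrt (\<pi> z) * g $ z) = sqrt (\<pi> z) * g $ z" for z
      using pos[of z] real_div_sqrt[of "\<pi> z"] by (simp flip: times_divide_eq_left)
    then have "(\<Sum>z\<in>UNIV. \<pi> z * pi_scale (\<lambda>z. 1 / \<pi> z) g $ z) = ?s \<bullet> g"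
      unfolding inner_vec_def pi_scale_def by (intro sum.cong) (simp_all add: real_sqrt_divide)
    then have "pi_scale (\<lambda>z. 1 / \<pi> z) g \<in> l2_0 \<pi>"
      using g by (simp add: l2_0_def)
    then show "g \<in> pi_scale \<pi> ` l2_0 \<pi>"
      by (rule rev_image_eqI) (simp add: pi_scale_inverse pos)
  next
    fix g assume "g \<in> pi_scale \<pi> ` l2_0 \<pi>"
    then show "g \<in> {g. ?s \<bullet> g = 0}"
      using pos by (auto simp: l2_0_def inner_vec_def pi_scale_def less_imp_le
          simp flip: mult.assoc)
  qed
  moreover have "?s \<noteq> 0"
  proof
    assume "?s = 0"
    then have "sqrt (\<pi> undefined) = 0" by (metis vec_lambda_beta zero_index)
    with pos[of undefined] show False by simp
  qed
  ultimately show ?thesis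
    using dim_hyperplane[of ?s] dim_pi_scale_image[of "l2_0 \<pi>"] by simp
qed

lemma pi_scale_eigenspace:
  "pi_scale \<pi> ` l2_0_eigenspace \<pi> A c = {g \<in> pi_scale \<pi> ` l2_0 \<pi>. conj_op g = c *\<^sub>R g}"
proof -
  have "A *v f = c *\<^sub>R f \<longleftrightarrow> conj_op (pi_scale \<pi> f) = c *\<^sub>R pi_scale \<pi> f" for f
    using inj_pi_scale
    by (metis conj_op_pi_scale injD linear_scale[OF linear_pi_scale])
  then show ?thesis by (auto simp: l2_0_eigenspace_def)
qed

lemma sum_dim_l2_0_eigenspace:
  shows finite_l2_0_eigenvalues: "finite (l2_0_eigenvalues \<pi> A)"
    and "(\<Sum>c\<in>l2_0_eigenvalues \<pi> A. dim (l2_0_eigenspace \<pi> A c)) = CARD('a) - 1"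
proof -
  let ?E = "\<lambda>c. {g \<in> pi_scale \<pi> ` l2_0 \<pi>. conj_op g = c *\<^sub>R g}"
  have inv: "conj_op f \<in> pi_scale \<pi> ` l2_0 \<pi>" if "f \<in> pi_scale \<pi> ` l2_0 \<pi>" for f
    using that invariant by (auto simp: conj_op_pi_scale)
  have eig: "l2_0_eigenvalues \<pi> A = {c. \<exists>f \<in> ?E c. f \<noteq> 0}"
    unfolding l2_0_eigenvalues_def pi_scale_eigenspace[symmetric] by (auto simp: pi_scale_eq_0)
  note sum = sum_dim_eigenspaces[OF linear_conj_op conj_op_self_adjoint
      linear_subspace_image[OF linear_pi_scale subspace_l2_0] inv]
  show "finite (l2_0_eigenvalues \<pi> A)"
    unfolding eig by (rule sum(1))
  show "(\<Sum>c\<in>l2_0_eigenvalues \<pi> A. dim (l2_0_eigenspace \<pi> A c)) = CARD('a) - 1"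
    using sum(2) unfolding eig[symmetric] unfolding pi_scale_eigenspace[symmetric]
    by (simp add: dim_pi_scale_image dim_l2_0)
qed

lemma sorted_l2_0_spectrum: "sorted (l2_0_spectrum \<pi> A)"
  unfolding l2_0_spectrum_def by (rule sorted_concat_replicate) simp

lemma length_l2_0_spectrum: "length (l2_0_spectrum \<pi> A) = CARD('a) - 1"
  unfolding l2_0_spectrum_def
  by (simp add: length_concat_replicate finite_l2_0_eigenvalues sum_dim_l2_0_eigenspace(2))

lemma count_list_l2_0_spectrum:
  "c \<in> l2_0_eigenvalues \<pi> A \<Longrightarrow> count_list (l2_0_spectrum \<pi> A) c = dim (l2_0_eigenspace \<pi> A c)"
  unfolding l2_0_spectrum_def
  by (simp add: count_list_concat_replicate finite_l2_0_eigenvalues)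

lemma eigenvector_in_l2_0_spectrum:
  assumes "u \<in> l2_0 \<pi>" "u \<noteq> 0" "A *v u = c *\<^sub>R u"
  shows "c \<in> l2_0_eigenvalues \<pi> A" and "c \<in> set (l2_0_spectrum \<pi> A)"
proof -
  have u: "u \<in> l2_0_eigenspace \<pi> A c" using assms by (simp add: l2_0_eigenspace_def)
  then show c: "c \<in> l2_0_eigenvalues \<pi> A"
    using assms(2) by (auto simp: l2_0_eigenvalues_def)
  have "dim (l2_0_eigenspace \<pi> A c) \<noteq> 0" using u assms(2) by auto
  then show "c \<in> set (l2_0_spectrum \<pi> A)"
    using count_list_l2_0_spectrum[OF c] by (metis count_list_0_iff)
qed

text \<open>The orthogonal complement \<open>W\<close> of \<open>\<phi>\<close> in
  \<open>l2_0 \<pi>\<close> is invariant because \<open>\<phi>\<close> is an eigenvector. The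
  minimal Rayleigh quotient on \<open>W\<close> is an eigenvalue \<open>m\<close>, and it remains to
  see that \<open>m\<close> is not below the second list entry.\<close>

lemma l2_0_spectrum_1_rayleigh:
  assumes \<phi>: "\<phi> \<in> l2_0 \<pi>" "\<phi> \<noteq> 0" "A *v \<phi> = (l2_0_spectrum \<pi> A ! 0) *\<^sub>R \<phi>"
    and w: "w \<in> l2_0 \<pi>" "pi_inner \<pi> \<phi> w = 0"
  shows "l2_0_spectrum \<pi> A ! 1 * pi_inner \<pi> w w \<le> pi_inner \<pi> w (A *v w)"
proof (cases "w = 0")
  case True
  then show ?thesis by (simp add: pi_inner_def)
next
  case False
  let ?L = "l2_0_spectrum \<pi> A"
  define W where "W = {f \<in> l2_0 \<pi>. pi_inner \<pi> \<phi> f = 0}"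
  have "subspace W"
    using subspace_l2_0[of \<pi>]
    by (auto simp: W_def subspace_def pi_inner_add_right pi_inner_scaleR_right)
      (simp add: pi_inner_def)
  moreover have "A *v f \<in> W" if "f \<in> W" for f
    using that invariant self_adjoint[of \<phi> f] \<phi>(3) by (simp add: W_def pi_inner_scaleR_left)
  moreover have "w \<in> W" using w by (simp add: W_def)
  moreover from this have "W \<noteq> {0}" using False by blast
  ultimately obtain u m where u: "u \<in> W" "u \<noteq> 0" "A *v u = m *\<^sub>R u"
      and bound: "m * pi_inner \<pi> w w \<le> pi_inner \<pi> w (A *v w)"
    using rayleigh_min_eigenvector_pi[of W] by blast
  have u0: "u \<in> l2_0 \<pi>" "pi_inner \<pi> \<phi> u = 0" using u(1) by (auto simp: W_def)
  note m = eigenvector_in_l2_0_spectrum[OF u0(1) u(2,3)]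
  have "?L ! 1 \<le> m"
  proof (rule nth_1_le_of_count_list[OF sorted_l2_0_spectrum m(2)])
    \<comment> \<open>When \<open>m\<close> equals the smallest eigenvalue, \<open>u\<close> and
      \<open>\<phi>\<close> are independent vectors of the same eigenspace, so \<open>m\<close> is
      listed at least twice.\<close>
    assume eq: "m = ?L ! 0"
    have "pi_inner \<pi> \<phi> \<phi> \<noteq> 0"
      using \<phi>(2) pos by (metis inner_eq_zero_iff pi_scale_eq_0 pi_scale_inner)
    then have "u \<notin> span {\<phi>}"
      using u(2) u0(2) by (auto simp: span_singleton pi_inner_scaleR_right)
    then have "independent {u, \<phi>}" "u \<noteq> \<phi>"
      using \<phi>(2) by (auto simp: independent_insert intro: span_base)
    moreover have "{u, \<phi>} \<subseteq> l2_0_eigenspace \<pi> A m"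
      using u \<phi> u0 eq by (auto simp: l2_0_eigenspace_def)
    ultimately have "2 \<le> dim (l2_0_eigenspace \<pi> A m)"
      using independent_card_le_dim[of "{u, \<phi>}" "l2_0_eigenspace \<pi> A m"] by simp
    then show "2 \<le> count_list ?L m"
      using count_list_l2_0_spectrum[OF m(1)] by simp
  qed
  then have "?L ! 1 * pi_inner \<pi> w w \<le> m * pi_inner \<pi> w w"
    by (intro mult_right_mono pi_inner_self_nonneg pos)
  with bound show ?thesis by linarith
qed

end

text \<open>The minimum principle for \<open>- A\<close> on all of \<open>l2_0 \<pi>\<close>, with
  signs reversed.\<close>

lemma (in pi_self_adjoint) l2_0_spectrum_last_rayleigh:
  assumes w: "w \<in> l2_0 \<pi>"
  shows "pi_inner \<pi> w (A *v w) \<le> l2_0_spectrum \<pi> A ! (CARD('a) - 2) * pi_inner \<pi> w w"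
proof (cases "w = 0")
  case True
  then show ?thesis by (simp add: pi_inner_def)
next
  case False
  let ?L = "l2_0_spectrum \<pi> A"
  have neg: "(- A) *v f = - (A *v f)" for f
    using matrix_vector_mult_diff_rdistrib[of 0 A f] by simp
  interpret N: pi_self_adjoint \<pi> "- A"
    using pos self_adjoint invariant
    by unfold_locales
      (auto simp: neg pi_inner_minus_left pi_inner_minus_right intro: subspace_neg[OF subspace_l2_0])
  have ne: "l2_0 \<pi> \<noteq> {0}" using w False by blast
  obtain u m where u: "u \<in> l2_0 \<pi>" "u \<noteq> 0" "(- A) *v u = m *\<^sub>R u"
      and min: "\<forall>f\<in>l2_0 \<pi>. m * pi_inner \<pi> f f \<le> pi_inner \<pi> f ((- A) *v f)"
    using N.rayleigh_min_eigenvector_pi[OF subspace_l2_0 N.invariant ne] by blast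
  note bound = min[rule_format, OF w]
  have "A *v u = (- m) *\<^sub>R u"
    using u(3) by (simp add: neg) (metis minus_minus)
  then have "- m \<in> set ?L"
    using eigenvector_in_l2_0_spectrum(2) u(1,2) by blast
  then obtain k where k: "k < length ?L" "?L ! k = - m"
    by (auto simp: in_set_conv_nth)
  \<comment> \<open>Positions count from 0 and the list has length \<open>CARD('a) - 1\<close>, so
    \<open>CARD('a) - 2\<close> is its last position.\<close>
  then have "- m \<le> ?L ! (CARD('a) - 2)"
    using sorted_nth_mono[OF sorted_l2_0_spectrum, of k "CARD('a) - 2"] length_l2_0_spectrum by simp
  then have "- m * pi_inner \<pi> w w \<le> ?L ! (CARD('a) - 2) * pi_inner \<pi> w w"
    by (intro mult_right_mono pi_inner_self_nonneg pos)
  with bound show ?thesis by (simp add: neg pi_inner_minus_right)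
qed

subsection \<open>Two-block partitions and threshold sets\<close>

lemma sum_UNIV_split: "(\<Sum>z\<in>UNIV. f z) = (\<Sum>z\<in>S. f z) + (\<Sum>z\<in>- S. f z)"
  for S :: "'a::finite set" and f :: "'a \<Rightarrow> real"
  by (subst sum.union_disjoint[symmetric]) (auto intro: sum.cong)

text \<open>Completing the square in \<open>t\<close>. Only the last summand depends on
  \<open>t\<close>, so for positive mass the weighted mean is the optimal centre.\<close>

lemma sum_square_about_mean:
  fixes \<pi> f :: "'a::finite \<Rightarrow> real"
  assumes "(\<Sum>z\<in>S. \<pi> z) \<noteq> 0"
  shows "(\<Sum>z\<in>S. \<pi> z * (f z - t)\<^sup>2)
    = (\<Sum>z\<in>S. \<pi> z * (f z)\<^sup>2) - (\<Sum>z\<in>S. \<pi> z * f z)\<^sup>2 / (\<Sum>z\<in>S. \<pi> z)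
      + (\<Sum>z\<in>S. \<pi> z) * (t - (\<Sum>z\<in>S. \<pi> z * f z) / (\<Sum>z\<in>S. \<pi> z))\<^sup>2"
proof -
  have "(\<Sum>z\<in>S. \<pi> z * (f z - t)\<^sup>2) = (\<Sum>z\<in>S. \<pi> z * (f z)\<^sup>2 - 2 * t * (\<pi> z * f z) + t\<^sup>2 * \<pi> z)"
    by (intro sum.cong) (auto simp: power2_eq_square algebra_simps)
  also have "\<dots> = (\<Sum>z\<in>S. \<pi> z * (f z)\<^sup>2) - 2 * t * (\<Sum>z\<in>S. \<pi> z * f z) + t\<^sup>2 * (\<Sum>z\<in>S. \<pi> z)"
    by (simp add: sum.distrib sum_subtractf sum_distrib_left)
  finally have expand: "(\<Sum>z\<in>S. \<pi> z * (f z - t)\<^sup>2)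
      = (\<Sum>z\<in>S. \<pi> z * (f z)\<^sup>2) - 2 * t * (\<Sum>z\<in>S. \<pi> z * f z) + t\<^sup>2 * (\<Sum>z\<in>S. \<pi> z)" .
  have "q - 2 * t * s + t\<^sup>2 * p = q - s\<^sup>2 / p + p * (t - s / p)\<^sup>2" if "p \<noteq> 0" for p q s :: real
    using that by (simp add: field_simps power2_eq_square)
  with expand assms show ?thesis by simp
qed

text \<open>The orthogonal projection of the indicator of \<open>S\<close> onto
  \<open>l2_0 \<pi>\<close> when \<open>\<pi>\<close> has total mass 1.\<close>

definition centered_indicator :: "('a::finite \<Rightarrow> real) \<Rightarrow> 'a set \<Rightarrow> real ^ 'a" where
  "centered_indicator \<pi> S = (\<chi> z. (if z \<in> S then 1 else 0) - (\<Sum>y\<in>S. \<pi> y))"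

lemma pi_norm_power2: "(\<And>z. 0 < \<pi> z) \<Longrightarrow> (pi_norm \<pi> f)\<^sup>2 = pi_inner \<pi> f f"
  by (simp add: pi_norm_def pi_inner_self_nonneg)

lemma mat_1_minus_gibbs: "(mat 1 - gibbs \<pi> S) *v f = f - gibbs_op \<pi> S f"
  by (simp add: matrix_vector_mult_diff_rdistrib gibbs_apply)

lemma matrix_mult_nth_column: "(A ** B) $ x $ y = (A *v column y B) $ x"
  by (simp add: matrix_matrix_mult_def matrix_vector_mult_def column_def)

locale positive_distr =
  fixes \<pi> :: "'a::finite \<Rightarrow> real"
  assumes pos: "\<And>z. 0 < \<pi> z" and total: "(\<Sum>z\<in>UNIV. \<pi> z) = 1"
begin

abbreviation mass :: "'a set \<Rightarrow> real" where
  "mass S \<equiv> \<Sum>z\<in>S. \<pi> z"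

lemma mass_Compl: "mass (- S) = 1 - mass S"
  using sum_UNIV_split[of \<pi> S] total by simp

lemma mass_pos: "S \<noteq> {} \<Longrightarrow> 0 < mass S"
  by (intro sum_pos) (auto simp: pos)

lemma mass_less_1: "S \<noteq> UNIV \<Longrightarrow> mass S < 1"
  using mass_pos[of "- S"] mass_Compl[of S] by (auto simp: Compl_eq_Diff_UNIV)

lemma pi_inner_centered_indicator:
  assumes "f \<in> l2_0 \<pi>"
  shows "pi_inner \<pi> f (centered_indicator \<pi> S) = (\<Sum>z\<in>S. \<pi> z * f $ z)"
proof -
  have "pi_inner \<pi> f (centered_indicator \<pi> S)
      = (\<Sum>z\<in>UNIV. (if z \<in> S then \<pi> z * f $ z else 0)) - mass S * (\<Sum>z\<in>UNIV. \<pi> z * f $ z)"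
    unfolding pi_inner_def centered_indicator_def sum_distrib_left sum_subtractf[symmetric]
    by (intro sum.cong) (auto simp: algebra_simps)
  then show ?thesis using assms by (simp add: l2_0_def sum.If_cases)
qed

lemma centered_indicator_in_l2_0: "centered_indicator \<pi> S \<in> l2_0 \<pi>"
proof -
  have "(\<Sum>z\<in>UNIV. \<pi> z * centered_indicator \<pi> S $ z)
      = (\<Sum>z\<in>UNIV. (if z \<in> S then \<pi> z else 0)) - mass S * (\<Sum>z\<in>UNIV. \<pi> z)"
    unfolding centered_indicator_def sum_distrib_left sum_subtractf[symmetric]
    by (intro sum.cong) (auto simp: algebra_simps)
  then show ?thesis using total by (simp add: l2_0_def sum.If_cases)
qed

lemma pi_inner_centered_indicator_self:
  "pi_inner \<pi> (centered_indicator \<pi> S) (centered_indicator \<pi> S) = mass S * (1 - mass S)"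
  unfolding pi_inner_centered_indicator[OF centered_indicator_in_l2_0]
  by (simp add: centered_indicator_def sum_distrib_right)

text \<open>Each entry of \<open>gibbs \<pi> S ** P - stationary_kernel \<pi>\<close> is a function
  of \<open>x\<close> times a function of \<open>y\<close>, so the double sum of the Frobenius norm
  factors.\<close>

lemma gibbs_cost_eq:
  assumes row: "\<And>z. (\<Sum>y\<in>UNIV. P $ z $ y) = 1" and rev: "reversible_kernel \<pi> P"
    and S: "S \<noteq> {}" "S \<noteq> UNIV"
  shows "gibbs_cost \<pi> P S
    = pi_inner \<pi> (P *v centered_indicator \<pi> S) (P *v centered_indicator \<pi> S)
      / (mass S * (1 - mass S))"
proof -
  define p where "p = mass S"
  define g where "g = P *v centered_indicator \<pi> S"
  have p: "0 < p" "p < 1" using mass_pos mass_less_1 S by (auto simp: p_def)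
  have h: "(\<Sum>z\<in>S. P $ y $ z) = g $ y + p" for y
  proof -
    have "g $ y = (\<Sum>z\<in>UNIV. if z \<in> S then P $ y $ z else 0) - p * (\<Sum>z\<in>UNIV. P $ y $ z)"
      unfolding g_def matrix_vector_mult_def centered_indicator_def sum_distrib_left
        sum_subtractf[symmetric] vec_lambda_beta p_def
      by (intro sum.cong) (auto simp: algebra_simps)
    then show ?thesis by (simp add: row sum.If_cases)
  qed
  \<comment> \<open>Detailed balance turns weighted column sums into row sums, which
    \<open>h\<close> expresses through \<open>g\<close>.\<close>
  have col: "(\<Sum>z\<in>T. \<pi> z * column y P $ z) = \<pi> y * (\<Sum>z\<in>T. P $ y $ z)" for T y
    using rev by (simp add: column_def reversible_kernel_def sum_distrib_left)
  have entry: "(gibbs \<pi> S ** P - stationary_kernel \<pi>) $ x $ y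
      = \<pi> y * g $ y * (if x \<in> S then 1 / p else - 1 / (1 - p))" for x y
  proof -
    have "(\<Sum>z\<in>- S. P $ y $ z) = 1 - p - g $ y"
      using sum_UNIV_split[of "\<lambda>z. P $ y $ z" S] h[of y] row[of y] by simp
    moreover have "(gibbs \<pi> S ** P - stationary_kernel \<pi>) $ x $ y
        = (if x \<in> S then pi_mean \<pi> S (column y P) else pi_mean \<pi> (- S) (column y P)) - \<pi> y"
      by (simp add: matrix_mult_nth_column gibbs_apply gibbs_op_def stationary_kernel_def)
    ultimately show ?thesis
      using p by (simp add: pi_mean_def col h mass_Compl flip: p_def) (simp add: field_simps)
  qed
  let ?c = "\<lambda>x. if x \<in> S then 1 / p else - 1 / (1 - p)"
  have "gibbs_cost \<pi> P S
      = (\<Sum>x\<in>UNIV. \<Sum>y\<in>UNIV. \<pi> x / \<pi> y * (\<pi> y * g $ y * ?c x)\<^sup>2)"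
    unfolding gibbs_cost_def pi_frob_norm_def entry
    by (intro real_sqrt_pow2 sum_nonneg) (simp add: pos less_imp_le)
  also have "\<dots> = (\<Sum>x\<in>UNIV. \<Sum>y\<in>UNIV. (\<pi> x * (?c x)\<^sup>2) * (\<pi> y * g $ y * g $ y))"
    using pos[THEN less_imp_neq[THEN not_sym]]
    by (intro sum.cong) (auto simp: field_simps power2_eq_square)
  also have "\<dots> = (\<Sum>x\<in>UNIV. \<pi> x * (?c x)\<^sup>2) * pi_inner \<pi> g g"
    by (simp add: pi_inner_def sum_product)
  also have "(\<Sum>x\<in>UNIV. \<pi> x * (?c x)\<^sup>2) = mass S * (1 / p)\<^sup>2 + mass (- S) * (1 / (1 - p))\<^sup>2"
    by (simp add: sum_UNIV_split[of _ S] sum_distrib_right)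
  also have "\<dots> = 1 / (p * (1 - p))"
  proof -
    have "c * (1 / c)\<^sup>2 = 1 / c" for c :: real
      by (simp add: power2_eq_square)
    then have "mass S * (1 / p)\<^sup>2 + mass (- S) * (1 / (1 - p))\<^sup>2 = 1 / p + 1 / (1 - p)"
      by (simp only: mass_Compl p_def[symmetric])
    also have "\<dots> = 1 / (p * (1 - p))"
      using p by (simp add: field_simps)
    finally show ?thesis .
  qed
  finally show ?thesis by (simp add: g_def p_def)
qed

section \<open>The two-block defect as a 2-means cost\<close>

definition block_defect :: "real ^ 'a \<Rightarrow> 'a set \<Rightarrow> real" where
  "block_defect f S = (pi_norm \<pi> ((mat 1 - gibbs \<pi> S) *v f))\<^sup>2"

lemma block_defect_eq:
  "block_defect f S = (\<Sum>z\<in>S. \<pi> z * (f $ z - pi_mean \<pi> S f)\<^sup>2)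
    + (\<Sum>z\<in>- S. \<pi> z * (f $ z - pi_mean \<pi> (- S) f)\<^sup>2)"
proof -
  have "block_defect f S = (\<Sum>z\<in>UNIV. \<pi> z * (f $ z - gibbs_op \<pi> S f $ z)\<^sup>2)"
    unfolding block_defect_def mat_1_minus_gibbs pi_norm_power2[OF pos]
    by (simp add: pi_inner_def power2_eq_square mult.assoc)
  then show ?thesis
    by (simp add: sum_UNIV_split[of _ S] gibbs_op_def)
qed

lemma block_defect_Compl: "block_defect f (- S) = block_defect f S"
  by (simp add: block_defect_eq)

text \<open>Each block mean is the optimal centre of its block, so arbitrary centres
  \<open>a\<close> and \<open>b\<close> do no better.\<close>

lemma block_defect_le:
  assumes S: "S \<noteq> {}" "S \<noteq> UNIV"
  shows "block_defect f S \<le> (\<Sum>z\<in>UNIV. \<pi> z * (f $ z - (if z \<in> S then a else b))\<^sup>2)"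
proof -
  have mean: "(\<Sum>z\<in>T. \<pi> z * (f $ z - pi_mean \<pi> T f)\<^sup>2) \<le> (\<Sum>z\<in>T. \<pi> z * (f $ z - t)\<^sup>2)"
    if "T \<noteq> {}" for T t
    using mass_pos[OF that] by (simp add: sum_square_about_mean pi_mean_def)
  have "- S \<noteq> {}" using S(2) by blast
  then show ?thesis
    using mean[of S a] mean[of "- S" b] S(1)
    by (simp add: block_defect_eq sum_UNIV_split[of _ S])
qed

lemma sum_square_about_pi_mean:
  assumes "T \<noteq> {}"
  shows "(\<Sum>z\<in>T. \<pi> z * (f $ z - pi_mean \<pi> T f)\<^sup>2)
    = (\<Sum>z\<in>T. \<pi> z * (f $ z)\<^sup>2) - (\<Sum>z\<in>T. \<pi> z * f $ z)\<^sup>2 / mass T"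
  using mass_pos[OF assms] by (simp add: sum_square_about_mean pi_mean_def)

text \<open>The residual of projecting \<open>f\<close> onto the centered indicator. As
  \<open>f\<close> has mean zero, its block sums are opposite, and
  \<open>1 / p + 1 / (1 - p)\<close> collapses to \<open>1 / (p * (1 - p))\<close>.\<close>

lemma block_defect_unit:
  assumes f: "f \<in> l2_0 \<pi>" "pi_inner \<pi> f f = 1" and S: "S \<noteq> {}" "S \<noteq> UNIV"
  shows "block_defect f S = 1 - (pi_inner \<pi> f (centered_indicator \<pi> S))\<^sup>2 / (mass S * (1 - mass S))"
proof -
  define p where "p = mass S"
  define a where "a = (\<Sum>z\<in>S. \<pi> z * f $ z)"
  have p: "0 < p" "p < 1" using mass_pos mass_less_1 S by (auto simp: p_def)
  have q: "mass (- S) = 1 - p" by (simp add: mass_Compl p_def)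
  have "- S \<noteq> {}" using S(2) by blast
  have "(\<Sum>z\<in>- S. \<pi> z * f $ z) = - a"
    using f(1) sum_UNIV_split[of "\<lambda>z. \<pi> z * f $ z" S] by (simp add: l2_0_def a_def)
  moreover have "(\<Sum>z\<in>S. \<pi> z * (f $ z)\<^sup>2) + (\<Sum>z\<in>- S. \<pi> z * (f $ z)\<^sup>2) = 1"
    using f(2) sum_UNIV_split[of "\<lambda>z. \<pi> z * (f $ z)\<^sup>2" S]
    by (simp add: pi_inner_def power2_eq_square mult.assoc)
  ultimately have "block_defect f S = 1 - a\<^sup>2 / p - a\<^sup>2 / (1 - p)"
    using sum_square_about_pi_mean[OF S(1), of f] sum_square_about_pi_mean[OF \<open>- S \<noteq> {}\<close>, of f] q
    by (simp add: block_defect_eq flip: a_def p_def)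
  also have "\<dots> = 1 - a\<^sup>2 / (p * (1 - p))"
    using p by (simp add: field_simps)
  finally show ?thesis
    by (simp add: pi_inner_centered_indicator f(1) a_def p_def)
qed

lemma ex_le_mean:
  assumes "S \<noteq> {}"
  obtains z where "z \<in> S" "f $ z \<le> pi_mean \<pi> S f"
proof -
  have "\<exists>z\<in>S. f $ z \<le> pi_mean \<pi> S f"
  proof (rule ccontr)
    assume "\<not> ?thesis"
    then have "(\<Sum>z\<in>S. \<pi> z * pi_mean \<pi> S f) < (\<Sum>z\<in>S. \<pi> z * f $ z)"
      using assms pos by (intro sum_strict_mono) (auto simp: not_le)
    moreover have "(\<Sum>z\<in>S. \<pi> z * pi_mean \<pi> S f) = mass S * pi_mean \<pi> S f"
      by (simp add: sum_distrib_right)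
    ultimately show False
      using mass_pos[OF assms] by (simp add: pi_mean_def)
  qed
  with that show thesis by blast
qed

lemma ex_ge_mean:
  assumes "S \<noteq> {}"
  obtains z where "z \<in> S" "pi_mean \<pi> S f \<le> f $ z"
proof -
  have "pi_mean \<pi> S (- f) = - pi_mean \<pi> S f"
    by (simp add: pi_mean_def sum_negf)
  then show thesis
    using ex_le_mean[OF assms, of "- f"] that by auto
qed

text \<open>One step of one-dimensional 2-means: keep the two block means and reassign every state to the
  nearer one. The new blocks are separated by the midpoint of the means, and the defect does not grow.\<close>

lemma midpoint_threshold_defect_le:
  assumes S: "S \<noteq> {}" "S \<noteq> UNIV" and lt: "pi_mean \<pi> S f < pi_mean \<pi> (- S) f"
  obtains m where "{z. f $ z \<le> m} \<noteq> {}" "{z. f $ z \<le> m} \<noteq> UNIV"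
    "block_defect f {z. f $ z \<le> m} \<le> block_defect f S"
proof -
  let ?a = "pi_mean \<pi> S f" and ?b = "pi_mean \<pi> (- S) f"
  define m where "m = (?a + ?b) / 2"
  define T where "T = {z. f $ z \<le> m}"
  have "- S \<noteq> {}" using S(2) by blast
  \<comment> \<open>A state of \<open>S\<close> at or below the lower mean and a state of
    \<open>- S\<close> at or above the upper mean lie on different sides of the midpoint, so neither
    new block is empty.\<close>
  obtain y where "f $ y \<le> ?a" using ex_le_mean[OF S(1)] by metis
  then have ne: "T \<noteq> {}" using lt by (auto simp: T_def m_def intro!: exI[of _ y])
  obtain z where "?b \<le> f $ z" using ex_ge_mean[OF \<open>- S \<noteq> {}\<close>] by metis
  then have "z \<notin> T" using lt by (simp add: T_def m_def field_simps)
  then have proper: "T \<noteq> UNIV" by blast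
  \<comment> \<open>The difference of the two squared distances is affine in \<open>f $ z\<close>
    and changes sign exactly at \<open>m\<close>.\<close>
  have near: "(f $ z - (if z \<in> T then ?a else ?b))\<^sup>2 \<le> (f $ z - (if z \<in> S then ?a else ?b))\<^sup>2" for z
  proof -
    have "(f $ z - ?b)\<^sup>2 - (f $ z - ?a)\<^sup>2 = 2 * (?b - ?a) * (m - f $ z)"
      by (simp add: m_def power2_eq_square field_simps)
    moreover have "z \<in> T \<Longrightarrow> 0 \<le> 2 * (?b - ?a) * (m - f $ z)"
      using lt by (simp add: T_def)
    moreover have "z \<notin> T \<Longrightarrow> 2 * (?b - ?a) * (m - f $ z) \<le> 0"
      using lt by (simp add: T_def mult_nonneg_nonpos)
    ultimately show ?thesis by auto
  qed
  have "block_defect f T \<le> (\<Sum>z\<in>UNIV. \<pi> z * (f $ z - (if z \<in> T then ?a else ?b))\<^sup>2)"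
    by (rule block_defect_le[OF ne proper])
  also have "\<dots> \<le> (\<Sum>z\<in>UNIV. \<pi> z * (f $ z - (if z \<in> S then ?a else ?b))\<^sup>2)"
    by (intro sum_mono mult_left_mono near) (simp add: pos less_imp_le)
  also have "\<dots> = block_defect f S"
    by (simp add: block_defect_eq sum_UNIV_split[of _ S])
  finally show thesis using that ne proper unfolding T_def by blast
qed

end

section \<open>Sweep sets and threshold sets\<close>

lemma sweep_sets_proper:
  assumes "sweep_order f x" "T \<in> sweep_sets x"
  shows "T \<noteq> {}" and "T \<noteq> UNIV"
proof -
  obtain j where j: "T = x ` {1..j}" "1 \<le> j" "j \<le> CARD('a) - 1"
    using assms(2) by (auto simp: sweep_sets_def)
  show "T \<noteq> {}" using j by simp
  have "card T \<le> j" using card_image_le[of "{1..j}" x] j by simp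
  then show "T \<noteq> UNIV" using j by auto
qed

text \<open>Monotonicity along the order makes the indices with value at most \<open>m\<close> an
  initial segment. A threshold set contains all states of equal value or none, so the breaking of
  ties is immaterial.\<close>

lemma threshold_in_sweep_sets:
  fixes f :: "real ^ 'a::finite"
  assumes x: "sweep_order f x" and T: "{z. f $ z \<le> m} \<noteq> {}" "{z. f $ z \<le> m} \<noteq> UNIV"
  shows "{z. f $ z \<le> m} \<in> sweep_sets x"
proof -
  define J where "J = {i \<in> {1..CARD('a)}. f $ x i \<le> m}"
  have img: "{z. f $ z \<le> m} = x ` J"
  proof (intro equalityI subsetI)
    fix z assume z: "z \<in> {z. f $ z \<le> m}"
    obtain i where "i \<in> {1..CARD('a)}" "z = x i"
      using x unfolding sweep_order_def bij_betw_def by blast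
    with z show "z \<in> x ` J" by (auto simp: J_def)
  qed (auto simp: J_def)
  have "finite J" by (simp add: J_def)
  moreover have "J \<noteq> {}" using T(1) img by auto
  ultimately have max: "Max J \<in> J" "\<And>i. i \<in> J \<Longrightarrow> i \<le> Max J" by auto
  have J: "J = {1..Max J}"
  proof (intro equalityI subsetI)
    fix i assume i: "i \<in> {1..Max J}"
    then have "f $ x i \<le> f $ x (Max J)"
      using x max(1) unfolding sweep_order_def J_def by auto
    then show "i \<in> J" using i max(1) unfolding J_def by auto
  qed (use max in \<open>auto simp: J_def\<close>)
  have "Max J \<noteq> CARD('a)"
  proof
    assume "Max J = CARD('a)"
    then have "x ` J = UNIV"
      using J x unfolding sweep_order_def bij_betw_def by simp
    with T(2) img show False by simp
  qed
  then have "1 \<le> Max J" "Max J \<le> CARD('a) - 1"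
    using max(1) by (auto simp: J_def)
  then show ?thesis
    unfolding sweep_sets_def using img J by blast
qed

text \<open>If the block means differ, the midpoint step applies to \<open>S\<close> or to
  \<open>- S\<close>, whichever has the smaller mean; the defect is the same for both.\<close>

lemma (in positive_distr) sweep_defect_le:
  assumes x: "sweep_order f x" and "2 \<le> CARD('a)" and S: "S \<noteq> {}" "S \<noteq> UNIV"
  obtains T where "T \<in> sweep_sets x" "block_defect f T \<le> block_defect f S"
proof -
  have "- S \<noteq> {}" "- S \<noteq> UNIV" using S by auto
  consider "pi_mean \<pi> S f < pi_mean \<pi> (- S) f" | "pi_mean \<pi> (- S) f < pi_mean \<pi> S f"
    | "pi_mean \<pi> S f = pi_mean \<pi> (- S) f" by linarith
  then show thesis
  proof cases
    case 1
    then show thesis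
      using midpoint_threshold_defect_le[OF S 1] threshold_in_sweep_sets[OF x] that by metis
  next
    case 2
    then have lt: "pi_mean \<pi> (- S) f < pi_mean \<pi> (- (- S)) f" by simp
    show thesis
      using midpoint_threshold_defect_le[OF \<open>- S \<noteq> {}\<close> \<open>- S \<noteq> UNIV\<close> lt] threshold_in_sweep_sets[OF x]
        that block_defect_Compl by metis
  next
    case 3
    \<comment> \<open>With equal means the defect of \<open>S\<close> is the sum of squares about
      one common centre, which no partition exceeds. Any sweep set would do; the first exists since
      there are at least two states.\<close>
    define T where "T = x ` {1..1}"
    have T: "T \<in> sweep_sets x"
      unfolding sweep_sets_def T_def using \<open>2 \<le> CARD('a)\<close> by (intro CollectI exI[of _ 1]) simp
    let ?a = "pi_mean \<pi> S f"
    have "block_defect f T \<le> (\<Sum>z\<in>UNIV. \<pi> z * (f $ z - (if z \<in> T then ?a else ?a))\<^sup>2)"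
      by (rule block_defect_le[OF sweep_sets_proper[OF x T]])
    also have "\<dots> = block_defect f S"
      using 3 by (simp add: block_defect_eq sum_UNIV_split[of _ S])
    finally show thesis using T that by blast
  qed
qed

section \<open>Reversible kernels and two-sided bounds on the cost\<close>

lemma pi_inner_kernel_commute:
  assumes "reversible_kernel \<pi> P"
  shows "pi_inner \<pi> (P *v f) g = pi_inner \<pi> f (P *v g)"
proof -
  have "pi_inner \<pi> (P *v f) g = (\<Sum>x\<in>UNIV. \<Sum>y\<in>UNIV. \<pi> x * P $ x $ y * f $ y * g $ x)"
    by (simp add: pi_inner_def matrix_vector_mult_def sum_distrib_left sum_distrib_right
        mult.assoc)
  also have "\<dots> = (\<Sum>y\<in>UNIV. \<Sum>x\<in>UNIV. \<pi> x * P $ x $ y * f $ y * g $ x)"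
    by (rule sum.swap)
  also have "\<dots> = (\<Sum>y\<in>UNIV. \<Sum>x\<in>UNIV. \<pi> y * P $ y $ x * f $ y * g $ x)"
    using assms by (simp add: reversible_kernel_def)
  also have "\<dots> = pi_inner \<pi> f (P *v g)"
    by (simp add: pi_inner_def matrix_vector_mult_def sum_distrib_left mult_ac)
  finally show ?thesis .
qed

text \<open>\<open>l2_0 \<pi>\<close> is the orthogonal complement of the constant 1, which
  \<open>P\<close> fixes and self-adjointness moves across the inner product.\<close>

lemma kernel_preserves_l2_0:
  assumes "reversible_kernel \<pi> P" and row: "\<And>z. (\<Sum>y\<in>UNIV. P $ z $ y) = 1" and "f \<in> l2_0 \<pi>"
  shows "P *v f \<in> l2_0 \<pi>"
proof -
  have l2_0: "g \<in> l2_0 \<pi> \<longleftrightarrow> pi_inner \<pi> 1 g = 0" for g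
    by (simp add: l2_0_def pi_inner_def)
  have "P *v 1 = 1" by (simp add: vec_eq_iff matrix_vector_mult_def row)
  then show ?thesis
    using pi_inner_kernel_commute[OF assms(1), of 1 f] assms(3) by (simp add: l2_0)
qed

locale reversible_setup = positive_distr \<pi> for \<pi> :: "'a::finite \<Rightarrow> real" +
  fixes P :: "real ^ 'a ^ 'a"
  assumes row: "\<And>z. (\<Sum>y\<in>UNIV. P $ z $ y) = 1" and rev: "reversible_kernel \<pi> P"
begin

sublocale sq: pi_self_adjoint \<pi> "P ** P"
  by unfold_locales
    (simp_all add: pos kernel_preserves_l2_0 rev row pi_inner_kernel_commute
      flip: matrix_vector_mul_assoc)

lemma gibbs_cost_bounds:
  fixes \<phi> :: "real ^ 'a" and S :: "'a set"
  defines "\<eta> \<equiv> sq_eigenvalue \<pi> P"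
  assumes \<phi>: "\<phi> \<in> l2_0 \<pi>" "(P ** P) *v \<phi> = \<eta> 1 *\<^sub>R \<phi>" "pi_inner \<pi> \<phi> \<phi> = 1"
    and S: "S \<noteq> {}" "S \<noteq> UNIV"
  shows "\<eta> 1 + (\<eta> 2 - \<eta> 1) * block_defect \<phi> S \<le> gibbs_cost \<pi> P S"
    and "gibbs_cost \<pi> P S \<le> \<eta> 1 + (\<eta> (CARD('a) - 1) - \<eta> 1) * block_defect \<phi> S"
proof -
  define v where "v = centered_indicator \<pi> S"
  define r where "r = mass S * (1 - mass S)"
  define a where "a = pi_inner \<pi> \<phi> v"
  define w where "w = v + (- a) *\<^sub>R \<phi>"
  have r: "0 < r" using mass_pos mass_less_1 S by (simp add: r_def)
  have v: "v \<in> l2_0 \<pi>" "pi_inner \<pi> v v = r"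
    by (simp_all add: v_def r_def centered_indicator_in_l2_0 pi_inner_centered_indicator_self)
  have w: "w \<in> l2_0 \<pi>"
    unfolding w_def by (intro subspace_add subspace_scale subspace_l2_0 v \<phi>)
  have \<phi>w: "pi_inner \<pi> \<phi> w = 0"
    by (simp only: w_def pi_inner_add_right pi_inner_scaleR_right \<phi>(3) a_def[symmetric])
  have vw: "pi_inner \<pi> v \<phi> = a" by (simp add: a_def pi_inner_commute)
  have ww: "pi_inner \<pi> w w = r - a\<^sup>2"
    by (simp only: w_def pi_inner_add_right pi_inner_add_left pi_inner_scaleR_right
        pi_inner_scaleR_left \<phi>(3) v(2) vw a_def[symmetric]) (simp add: power2_eq_square)
  \<comment> \<open>The \<open>\<phi>\<close> component of the image is orthogonal to
    \<open>w\<close> and drops out. What remains expresses the quadratic form at \<open>w\<close>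
    through the cost of \<open>S\<close> and \<open>a\<close>.\<close>
  have "(P ** P) *v w = (P ** P) *v v + (- a * \<eta> 1) *\<^sub>R \<phi>"
    by (simp only: w_def matrix_vector_right_distrib matrix_vector_mult_scaleR \<phi>(2) scaleR_scaleR)
  then have "pi_inner \<pi> w ((P ** P) *v w) = pi_inner \<pi> w ((P ** P) *v v)"
    by (simp only: pi_inner_add_right pi_inner_scaleR_right pi_inner_commute[of _ w \<phi>] \<phi>w)
  also have "\<dots> = pi_inner \<pi> v ((P ** P) *v v) - a * pi_inner \<pi> ((P ** P) *v \<phi>) v"
    by (simp only: w_def pi_inner_add_left pi_inner_scaleR_left sq.self_adjoint)
  also have "pi_inner \<pi> v ((P ** P) *v v) = r * gibbs_cost \<pi> P S"
    using gibbs_cost_eq[OF row rev S] r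
    by (simp add: pi_inner_kernel_commute[OF rev] matrix_vector_mul_assoc flip: v_def r_def)
  also have "pi_inner \<pi> ((P ** P) *v \<phi>) v = \<eta> 1 * a"
    by (simp add: \<phi>(2) pi_inner_scaleR_left a_def)
  finally have wAw: "pi_inner \<pi> w ((P ** P) *v w) = r * gibbs_cost \<pi> P S - a * (\<eta> 1 * a)" .
  \<comment> \<open>The squared norm of \<open>w\<close> is the fraction
    \<open>block_defect \<phi> S\<close> of the squared norm \<open>r\<close> of \<open>v\<close>;
    this is how the defect enters both bounds.\<close>
  have d: "r - a\<^sup>2 = r * block_defect \<phi> S"
    using block_defect_unit[OF \<phi>(1,3) S] r by (simp add: field_simps flip: v_def r_def a_def)
  then have d': "a * (\<eta> 1 * a) = \<eta> 1 * (r - r * block_defect \<phi> S)"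
  proof -
    have "a\<^sup>2 = r - r * block_defect \<phi> S" using d by simp
    then show ?thesis by (simp add: power2_eq_square mult_ac)
  qed
  have "\<phi> \<noteq> 0" using \<phi>(3) by (auto simp: pi_inner_def)
  then have "\<eta> 2 * (r - a\<^sup>2) \<le> r * gibbs_cost \<pi> P S - a * (\<eta> 1 * a)"
    using sq.l2_0_spectrum_1_rayleigh[OF \<phi>(1) _ _ w \<phi>w] \<phi>(2) ww wAw
    by (simp add: \<eta>_def sq_eigenvalue_def)
  then have "r * (\<eta> 1 + (\<eta> 2 - \<eta> 1) * block_defect \<phi> S) \<le> r * gibbs_cost \<pi> P S"
    unfolding d d' by (simp add: algebra_simps)
  then show "\<eta> 1 + (\<eta> 2 - \<eta> 1) * block_defect \<phi> S \<le> gibbs_cost \<pi> P S"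
    using r by simp
  \<comment> \<open>Eigenvalue number \<open>CARD('a) - 1\<close>, counted from 1, is list position
    \<open>CARD('a) - 2\<close>.\<close>
  have "r * gibbs_cost \<pi> P S - a * (\<eta> 1 * a) \<le> \<eta> (CARD('a) - 1) * (r - a\<^sup>2)"
    using sq.l2_0_spectrum_last_rayleigh[OF w] ww wAw
    by (simp add: \<eta>_def sq_eigenvalue_def numeral_2_eq_2)
  then have "r * gibbs_cost \<pi> P S \<le> r * (\<eta> 1 + (\<eta> (CARD('a) - 1) - \<eta> 1) * block_defect \<phi> S)"
    unfolding d d' by (simp add: algebra_simps)
  then show "gibbs_cost \<pi> P S \<le> \<eta> 1 + (\<eta> (CARD('a) - 1) - \<eta> 1) * block_defect \<phi> S"
    using r by simp
qed

lemma sq_eigenvalue_mono: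
  "1 \<le> i \<Longrightarrow> i \<le> j \<Longrightarrow> j \<le> CARD('a) - 1 \<Longrightarrow> sq_eigenvalue \<pi> P i \<le> sq_eigenvalue \<pi> P j"
  unfolding sq_eigenvalue_def
  by (intro sorted_nth_mono sq.sorted_l2_0_spectrum) (auto simp: sq.length_l2_0_spectrum)

end

theorem theorem3p2:
  fixes \<pi> :: "'a::finite \<Rightarrow> real"
    and P :: "real ^ 'a ^ 'a"
    and \<phi> :: "real ^ 'a"
    and x :: "nat \<Rightarrow> 'a"
    and S_hat :: "'a set"
    and \<eta> :: "nat \<Rightarrow> real"
  assumes "CARD('a) \<ge> 3"
    and "prob_distr \<pi>" and "\<forall>z. 0 < \<pi> z"
    and "markov_kernel P" and "ergodic_kernel P" and "reversible_kernel \<pi> P"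
    and "\<eta> = sq_eigenvalue \<pi> P"
    and "\<phi> \<in> l2_0 \<pi>" and "(P ** P) *v \<phi> = \<eta> 1 *\<^sub>R \<phi>" and "pi_norm \<pi> \<phi> = 1"
    and "sweep_order \<phi> x"
    and "sweep_output \<pi> P x S_hat"
  shows "\<eta> 1 + (\<eta> 2 - \<eta> 1) * two_block_defect \<pi> \<phi> \<le> two_block_opt \<pi> P
    \<and> two_block_opt \<pi> P \<le> gibbs_cost \<pi> P S_hat
    \<and> gibbs_cost \<pi> P S_hat \<le> \<eta> 1 + (\<eta> (CARD('a) - 1) - \<eta> 1) * two_block_defect \<pi> \<phi>
    \<and> 0 \<le> gibbs_cost \<pi> P S_hat - two_block_opt \<pi> P
    \<and> gibbs_cost \<pi> P S_hat - two_block_opt \<pi> P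
        \<le> (\<eta> (CARD('a) - 1) - \<eta> 2) * two_block_defect \<pi> \<phi>
    \<and> (\<eta> 2 > \<eta> 1 \<longrightarrow>
        gibbs_cost \<pi> P S_hat - \<eta> 1
          \<le> (\<eta> (CARD('a) - 1) - \<eta> 1) / (\<eta> 2 - \<eta> 1) * (two_block_opt \<pi> P - \<eta> 1))"
proof -
  interpret reversible_setup \<pi> P
    using assms(2-4,6) by unfold_locales (auto simp: prob_distr_def markov_kernel_def)
  let ?\<S> = "{S :: 'a set. S \<noteq> {} \<and> S \<noteq> UNIV}"
  let ?F = "gibbs_cost \<pi> P" and ?F2 = "two_block_opt \<pi> P" and ?\<delta> = "two_block_defect \<pi> \<phi>"
  let ?top = "\<eta> (CARD('a) - 1)"
  have one: "pi_inner \<pi> \<phi> \<phi> = 1"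
    using assms(10) pi_norm_power2[of \<pi> \<phi>] pos by simp
  note bounds = gibbs_cost_bounds[OF assms(8) assms(9)[unfolded assms(7)] one, folded assms(7)]
  \<comment> \<open>Three states ensure \<open>2 \<le> CARD('a) - 1\<close>, so that
    \<open>\<eta> 2\<close> is a genuine list entry. These signs permit multiplying inequalities by
    the spectral gaps.\<close>
  have mono: "\<eta> 1 \<le> \<eta> 2" "\<eta> 1 \<le> ?top"
    unfolding assms(7) using assms(1) by (auto intro!: sq_eigenvalue_mono)
  have S_hat: "S_hat \<in> sweep_sets x" "\<And>T. T \<in> sweep_sets x \<Longrightarrow> ?F S_hat \<le> ?F T"
    using assms(12) by (auto simp: sweep_output_def is_arg_min_linorder)
  then have S_hat': "S_hat \<in> ?\<S>"
    using sweep_sets_proper[OF assms(11)] by blast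
  \<comment> \<open>Nonemptiness makes both minima attained values.\<close>
  then have ne: "?\<S> \<noteq> {}" by blast
  have \<delta>: "?\<delta> = Min (block_defect \<phi> ` ?\<S>)"
    by (simp add: two_block_defect_def block_defect_def)
  have \<delta>_le: "?\<delta> \<le> block_defect \<phi> S" if "S \<in> ?\<S>" for S
    unfolding \<delta> using that by (intro Min_le) auto
  have "?\<delta> \<in> block_defect \<phi> ` ?\<S>"
    unfolding \<delta> using ne by (intro Min_in) simp_all
  then obtain S0 where S0: "S0 \<in> ?\<S>" "?\<delta> = block_defect \<phi> S0" by blast
  have "?F2 \<in> ?F ` ?\<S>"
    unfolding two_block_opt_def using ne by (intro Min_in) simp_all
  then obtain S1 where S1: "S1 \<in> ?\<S>" "?F2 = ?F S1" by blast
  \<comment> \<open>The lower bound is taken at the cost minimizer \<open>S1\<close>, whose defect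
    is at least the minimal one.\<close>
  have "(\<eta> 2 - \<eta> 1) * ?\<delta> \<le> (\<eta> 2 - \<eta> 1) * block_defect \<phi> S1"
    using mono \<delta>_le[OF S1(1)] by (intro mult_left_mono) auto
  then have lower: "\<eta> 1 + (\<eta> 2 - \<eta> 1) * ?\<delta> \<le> ?F2"
    using bounds(1)[of S1] S1 by auto
  have opt: "?F2 \<le> ?F S_hat"
    unfolding two_block_opt_def using S_hat' by (intro Min_le) auto
  \<comment> \<open>The upper bound is taken at a sweep set no worse in defect than the global
    defect minimizer \<open>S0\<close>; the output \<open>S_hat\<close> costs no more than this
    set.\<close>
  obtain T where T: "T \<in> sweep_sets x" "block_defect \<phi> T \<le> block_defect \<phi> S0"
    using sweep_defect_le[OF assms(11), of S0] S0(1) assms(1) by auto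
  have "?F S_hat \<le> ?F T" using S_hat(2) T(1) by blast
  also have "\<dots> \<le> \<eta> 1 + (?top - \<eta> 1) * block_defect \<phi> T"
    by (rule bounds(2)[OF sweep_sets_proper[OF assms(11) T(1)]])
  also have "\<dots> \<le> \<eta> 1 + (?top - \<eta> 1) * ?\<delta>"
    using T(2) S0(2) mono by (intro add_left_mono mult_left_mono) auto
  finally have upper: "?F S_hat \<le> \<eta> 1 + (?top - \<eta> 1) * ?\<delta>" .
  have diff: "?F S_hat - ?F2 \<le> (?top - \<eta> 2) * ?\<delta>"
    using lower upper by (simp add: algebra_simps)
  have ratio: "?F S_hat - \<eta> 1 \<le> (?top - \<eta> 1) / (\<eta> 2 - \<eta> 1) * (?F2 - \<eta> 1)" if "\<eta> 1 < \<eta> 2"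
  proof -
    \<comment> \<open>The lower bound solved for \<open>?\<delta>\<close>, to be inserted into the
      upper bound.\<close>
    have "?\<delta> \<le> (?F2 - \<eta> 1) / (\<eta> 2 - \<eta> 1)"
      using lower that by (simp add: pos_le_divide_eq algebra_simps)
    then have "(?top - \<eta> 1) * ?\<delta> \<le> (?top - \<eta> 1) * ((?F2 - \<eta> 1) / (\<eta> 2 - \<eta> 1))"
      using mono by (intro mult_left_mono) auto
    then show ?thesis using upper by simp
  qed
  show ?thesis using lower opt upper diff ratio by auto
qed

end
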